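(* Let $n\ge3$ and let $\mathcal R$ be the orbit equivalence relation of an ergodic probability-measure-preserving essentially free action of $SL(n,\mathbb Z)$ on a standard probability space $(X,\mu)$. Then $\mathcal R$ has higher rank, i.e. $\mathcal R$ does not have rank 1.
   Context: The orbit equivalence relation of an action $G\curvearrowright X$ is $\{(x,gx):x\in X,g\in G\}$. For a discrete (countable classes) Borel equivalence relation $\mathcal R$ on $(X,\mu)$ for which $\mu$ is $\mathcal R$-invariant (i.e. preserved by every Borel isomorphism of $X$ with graph in $\mathcal R$), let $\hat\mu(F)=\int|\{y:(x,y)\in F\}|\,d\mu(x)$ for $F\subset\mathcal R$. A subequivalence relation $\mathcal S\le\mathcal R$ is a Borel subset of $\mathcal R$ that is an equivalence relation on $X$; it is aperiodic if a.e. class is infinite; it is hyperfinite if there are Borel subequivalence relations $\mathcal S_1\le\mathcal S_2\le\cdots$ with all $\mathcal S_n$-classes finite and $\mathcal S=\bigcup_n\mathcal S_n$. All notions are understood up to null sets (subequivalence relations with $\hat\mu$-null symmetric difference are identified). A hyperfinite $\mathcal S\le\mathcal R$ is maximal hyperfinite if there is no hyperfinite $\mathcal S'\le\mathcal R$ with $\mathcal S\le\mathcal S'$ and $\hat\mu(\mathcal S'\setminus\mathcal S)>0$. $\mathcal R$ has rank 1 if every aperiodic hyperfinite subequivalence relation of $\mathcal R$ is contained in a unique (up to null sets) maximal hyperfinite subequivalence relation; it has higher rank if it does not have rank 1. *)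

theory Defs
  imports
    "HOL-Analysis.Analysis"
    "HOL-Probability.Probability_Measure"
    "HOL-Algebra.Group_Action"
begin

section \<open>The group $SL(n,\mathbb{Z})$\<close>

text \<open>The dimension is the cardinality of the finite index type \<open>'n\<close>.\<close>

definition SL_int :: "(int ^ 'n ^ 'n) monoid" where
  "SL_int = \<lparr>carrier = {A. det A = 1}, mult = (**), one = mat 1\<rparr>"

lemma of_int_det: "(of_int (det A) :: rat) = det (\<chi> i j. of_int (A $ i $ j))"
  for A :: "int ^ 'n ^ 'n"
  by (simp add: det_def)

lemma SL_int_left_inverse:
  fixes A :: "int ^ 'n ^ 'n"
  assumes A: "det A = 1"
  shows "\<exists>B. det B = 1 \<and> B ** A = mat 1"
proof -
  define A' :: "rat ^ 'n ^ 'n" where "A' = (\<chi> i j. of_int (A $ i $ j))"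
  define B :: "int ^ 'n ^ 'n"
    where "B = (\<chi> k l. det (\<chi> i j. if j = k then (if i = l then 1 else 0) else A $ i $ j))"
  define B' :: "rat ^ 'n ^ 'n" where "B' = (\<chi> i j. of_int (B $ i $ j))"
  have dA': "det A' = 1"
    using of_int_det[of A] A by (simp add: A'_def)
  have B'_entry: "B' $ k $ l = det (\<chi> i j. if j = k then axis l 1 $ i else A' $ i $ j)" for k l
  proof -
    have "B' $ k $ l
        = det (\<chi> i j. of_int ((\<chi> i j. if j = k then (if i = l then 1 else 0) else A $ i $ j) $ i $ j))"
      by (simp only: B'_def B_def vec_lambda_beta of_int_det)
    also have "\<dots> = det (\<chi> i j. if j = k then axis l 1 $ i else A' $ i $ j)"
      by (rule arg_cong[where f = det]) (auto simp: vec_eq_iff A'_def axis_def)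
    finally show ?thesis .
  qed
  have "A' *v (\<chi> k. B' $ k $ l) = axis l 1" for l
    using dA' by (subst cramer) (simp_all add: B'_entry)
  then have "(\<Sum>k\<in>UNIV. A' $ i $ k * B' $ k $ l) = axis l 1 $ i" for i l
    by (metis (no_types, lifting) matrix_vector_mult_def sum.cong vec_lambda_beta)
  then have "A' ** B' = mat 1"
    by (simp add: vec_eq_iff matrix_matrix_mult_def mat_def axis_def)
  then have "B' ** A' = mat 1"
    by (simp add: matrix_left_right_inverse)
  then have "(of_int ((B ** A) $ i $ j) :: rat) = of_int (mat 1 $ i $ j)" for i j
    by (auto simp: vec_eq_iff matrix_matrix_mult_def mat_def A'_def B'_def)
  then have BA: "B ** A = mat 1"
    by (simp only: of_int_eq_iff vec_eq_iff) simp
  then have "det B = 1"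
    using det_mul[of B A] A by simp
  with BA show ?thesis by blast
qed

lemma group_SL_int: "group SL_int"
  by (rule groupI)
     (auto simp: SL_int_def det_mul matrix_mul_assoc dest: SL_int_left_inverse)

section \<open>Probability-measure-preserving actions\<close>

definition standard_borel :: "'a measure \<Rightarrow> bool" where
  "standard_borel M \<longleftrightarrow>
     (\<exists>T. topspace T = space M \<and> completely_metrizable_space T \<and> second_countable T \<and>
          sets M = sigma_sets (space M) {U. openin T U})"

definition pmp_action ::
  "('g, 'b) monoid_scheme \<Rightarrow> 'a measure \<Rightarrow> ('g \<Rightarrow> 'a \<Rightarrow> 'a) \<Rightarrow> bool" where
  "pmp_action G M \<phi> \<longleftrightarrow>
     prob_space M \<and> group_action G (space M) \<phi> \<and>
     (\<forall>g\<in>carrier G. \<phi> g \<in> M \<rightarrow>\<^sub>M M \<and> distr M M (\<phi> g) = M)"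

definition ergodic_action ::
  "('g, 'b) monoid_scheme \<Rightarrow> 'a measure \<Rightarrow> ('g \<Rightarrow> 'a \<Rightarrow> 'a) \<Rightarrow> bool" where
  "ergodic_action G M \<phi> \<longleftrightarrow>
     (\<forall>A\<in>sets M. (\<forall>g\<in>carrier G. \<phi> g ` A = A) \<longrightarrow> emeasure M A = 0 \<or> emeasure M (space M - A) = 0)"

definition essentially_free ::
  "('g, 'b) monoid_scheme \<Rightarrow> 'a measure \<Rightarrow> ('g \<Rightarrow> 'a \<Rightarrow> 'a) \<Rightarrow> bool" where
  "essentially_free G M \<phi> \<longleftrightarrow> (AE x in M. stabilizer G \<phi> x = {\<one>\<^bsub>G\<^esub>})"

definition orbit_rel ::
  "('g, 'b) monoid_scheme \<Rightarrow> 'a measure \<Rightarrow> ('g \<Rightarrow> 'a \<Rightarrow> 'a) \<Rightarrow> ('a \<times> 'a) set" where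
  "orbit_rel G M \<phi> = {(x, \<phi> g x) |x g. x \<in> space M \<and> g \<in> carrier G}"

section \<open>Subequivalence relations\<close>

text \<open>
  In what follows \<open>R\<close> is thought of as a Borel equivalence relation with countable classes on the
  standard probability space \<open>M\<close> for which the measure is \<open>R\<close>-invariant. The definitions make
  sense for an arbitrary relation and do not repeat these standing assumptions.
\<close>

definition rel_measure :: "'a measure \<Rightarrow> ('a \<times> 'a) set \<Rightarrow> ennreal" where
  "rel_measure M F = (\<integral>\<^sup>+ x. emeasure (count_space UNIV) {y. (x, y) \<in> F} \<partial>M)"

definition subset_mod_null :: "'a measure \<Rightarrow> ('a \<times> 'a) set \<Rightarrow> ('a \<times> 'a) set \<Rightarrow> bool" where
  "subset_mod_null M S T \<longleftrightarrow> rel_measure M (S - T) = 0"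

definition eq_mod_null :: "'a measure \<Rightarrow> ('a \<times> 'a) set \<Rightarrow> ('a \<times> 'a) set \<Rightarrow> bool" where
  "eq_mod_null M S T \<longleftrightarrow> rel_measure M (sym_diff S T) = 0"

definition subeq_rel :: "'a measure \<Rightarrow> ('a \<times> 'a) set \<Rightarrow> ('a \<times> 'a) set \<Rightarrow> bool" where
  "subeq_rel M R S \<longleftrightarrow> S \<in> sets (M \<Otimes>\<^sub>M M) \<and> S \<subseteq> R \<and> equiv (space M) S"

definition aperiodic_rel :: "'a measure \<Rightarrow> ('a \<times> 'a) set \<Rightarrow> bool" where
  "aperiodic_rel M S \<longleftrightarrow> (AE x in M. infinite (S `` {x}))"

text \<open>
  The union of the finite subrelations is only required to be \<open>S\<close> up to a null set. They can be
  taken to be contained in \<open>S\<close> and to have only finite classes, since they may be replaced by the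
  identity relation on a null set of points.
\<close>

definition hyperfinite_rel :: "'a measure \<Rightarrow> ('a \<times> 'a) set \<Rightarrow> bool" where
  "hyperfinite_rel M S \<longleftrightarrow>
     (\<exists>T :: nat \<Rightarrow> ('a \<times> 'a) set.
        (\<forall>n. subeq_rel M S (T n) \<and> T n \<subseteq> T (Suc n) \<and> (\<forall>x\<in>space M. finite (T n `` {x}))) \<and>
        eq_mod_null M S (\<Union>n. T n))"

definition maximal_hyperfinite :: "'a measure \<Rightarrow> ('a \<times> 'a) set \<Rightarrow> ('a \<times> 'a) set \<Rightarrow> bool" where
  "maximal_hyperfinite M R S \<longleftrightarrow>
     subeq_rel M R S \<and> hyperfinite_rel M S \<and>
     \<not> (\<exists>S'. subeq_rel M R S' \<and> hyperfinite_rel M S' \<and>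
             subset_mod_null M S S' \<and> rel_measure M (S' - S) > 0)"

definition rank_one :: "'a measure \<Rightarrow> ('a \<times> 'a) set \<Rightarrow> bool" where
  "rank_one M R \<longleftrightarrow>
     (\<forall>S. subeq_rel M R S \<and> aperiodic_rel M S \<and> hyperfinite_rel M S \<longrightarrow>
        (\<exists>S'. maximal_hyperfinite M R S' \<and> subset_mod_null M S S' \<and>
              (\<forall>S''. maximal_hyperfinite M R S'' \<and> subset_mod_null M S S'' \<longrightarrow>
                     eq_mod_null M S' S'')))"

definition higher_rank :: "'a measure \<Rightarrow> ('a \<times> 'a) set \<Rightarrow> bool" where
  "higher_rank M R \<longleftrightarrow> \<not> rank_one M R"

end

theory Submission
  imports Defs
begin

text \<open>
  Suppose that the orbit relation has rank one. For distinct indices \<open>p\<close>, \<open>q\<close>, \<open>r\<close> the one-parameter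
  unipotent subgroups at the positions \<open>(p, q)\<close>, \<open>(p, r)\<close>, \<open>(q, r)\<close>, \<open>(q, p)\<close> commute consecutively.
  Each consecutive pair generates a copy of \<open>\<int>\<^sup>2\<close>, whose orbit relation is aperiodic and hyperfinite
  and thus lies in a maximal hyperfinite relation. Two neighbouring copies of \<open>\<int>\<^sup>2\<close> share the
  orbit relation of a copy of \<open>\<int>\<close>, so by rank one their maximal relations coincide up to null sets.
  Hence a single hyperfinite relation contains, up to null sets, the orbits of the transvections at
  \<open>(p, q)\<close> and at \<open>(q, p)\<close>. Their cubes play ping-pong, and this is incompatible with
  hyperfiniteness.

  Two analytic facts carry the argument.

  \<^item> A free measure-preserving action of \<open>\<int>\<^sup>2\<close> has hyperfinite orbits (lemma
    \<open>hyperfinite_plane_orbits\<close>). Choose markers that are separated at scale \<open>N\<close> but meet every ball of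
    radius \<open>N\<close>, and let each point pick one of the markers in its ball by a rule that depends only on
    which markers are there. Nearby points pick differently only if a marker lies near the boundary
    of the ball, which has probability of order \<open>1 / N\<close>.

  \<^item> Let \<open>a\<close> and \<open>b\<close> play ping-pong in the acting group. Then a relation with finite classes relates
    \<open>x\<close> to \<open>a x\<close> and \<open>x\<close> to \<open>b x\<close> with total probability at most 1 (lemma
    \<open>finite_relation_ping_pong\<close>), while inside a hyperfinite relation containing both graphs this
    total would have to tend to 2.
\<close>

section \<open>Measurable selection\<close>

text \<open>
  A countable base of a Polish topology separates points from finite sets in this way. Such a
  sequence makes graphs of measurable maps measurable and allows a measurable choice from finite
  sets.
\<close>
locale separating_sequence =
  fixes M :: "'a measure" and U :: "nat \<Rightarrow> 'a set"
  assumes U_sets [measurable]: "\<And>i. U i \<in> sets M"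
    and separates: "\<And>F x. finite F \<Longrightarrow> F \<subseteq> space M \<Longrightarrow> x \<in> space M - F \<Longrightarrow> \<exists>i. x \<in> U i \<and> U i \<inter> F = {}"
begin

lemma eq_iff_U:
  assumes "x \<in> space M" "y \<in> space M"
  shows "x = y \<longleftrightarrow> (\<forall>j. x \<in> U j \<longleftrightarrow> y \<in> U j)"
  using separates[of "{y}" x] assms by auto

lemma measurable_eq_pred:
  assumes [measurable]: "f \<in> N \<rightarrow>\<^sub>M M" "g \<in> N \<rightarrow>\<^sub>M M"
  shows "Measurable.pred N (\<lambda>x. f x = g x)"
proof -
  have "Measurable.pred N (\<lambda>x. \<forall>j. f x \<in> U j \<longleftrightarrow> g x \<in> U j)"
    by measurable
  moreover have "x \<in> space N \<Longrightarrow> (\<forall>j. f x \<in> U j \<longleftrightarrow> g x \<in> U j) \<longleftrightarrow> f x = g x" for x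
    using assms by (metis eq_iff_U measurable_space)
  ultimately show ?thesis
    by (subst measurable_cong[where g = "\<lambda>x. \<forall>j. f x \<in> U j \<longleftrightarrow> g x \<in> U j"]) auto
qed

text \<open>
  Some \<open>U i\<close> meets the finite set \<open>C x\<close> in exactly one point; the point selected is the one cut out
  by the least such \<open>i\<close>. This choice sees only the set \<open>C x\<close> and not \<open>x\<close>, so points with the same
  candidates select the same point; that is how kernels of selections become equivalence relations
  and how a class gets one root.
\<close>
lemma measurable_selection:
  fixes I :: "'i set" and f :: "'i \<Rightarrow> 'a \<Rightarrow> 'a"
  assumes I: "countable I"
    and f: "\<And>v. v \<in> I \<Longrightarrow> f v \<in> M \<rightarrow>\<^sub>M M"
    and P: "\<And>v. v \<in> I \<Longrightarrow> Measurable.pred M (P v)"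
    and C: "\<And>x. x \<in> space M \<Longrightarrow> C x = {f v x | v. v \<in> I \<and> P v x}"
    and fin: "\<And>x. x \<in> space M \<Longrightarrow> finite (C x)"
    and ne: "\<And>x. x \<in> space M \<Longrightarrow> C x \<noteq> {}"
  obtains r where "r \<in> M \<rightarrow>\<^sub>M M" "\<And>x. x \<in> space M \<Longrightarrow> r x \<in> C x" "\<And>x y. C x = C y \<Longrightarrow> r x = r y"
proof -
  note [measurable] = f P
  define L where "L x = (LEAST i. \<exists>m. C x \<inter> U i = {m})" for x
  define r where "r x = (THE m. C x \<inter> U (L x) = {m})" for x
  have C_space: "C x \<subseteq> space M" if "x \<in> space M" for x
    using that C[OF that] measurable_space[OF f] by auto
  have r: "C x \<inter> U (L x) = {r x}" if x: "x \<in> space M" for x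
  proof -
    obtain m where m: "m \<in> C x" using ne[OF x] by blast
    have "\<exists>i. m \<in> U i \<and> U i \<inter> (C x - {m}) = {}"
      using m fin[OF x] C_space[OF x] by (intro separates) auto
    then have "\<exists>i. \<exists>m. C x \<inter> U i = {m}" using m by blast
    then have "\<exists>m. C x \<inter> U (L x) = {m}" unfolding L_def by (rule LeastI_ex)
    then obtain k where k: "C x \<inter> U (L x) = {k}" by blast
    then have "r x = k" unfolding r_def by (intro the_equality) auto
    with k show ?thesis by simp
  qed
  have "Measurable.pred M (\<lambda>x. \<exists>m. C x \<inter> U i = {m})" for i
  proof -
    have [measurable]: "Measurable.pred M (\<lambda>x. f v x = f w x)" if "v \<in> I" "w \<in> I" for v w
      using that f by (intro measurable_eq_pred) auto
    have "Measurable.pred M (\<lambda>x. (\<exists>v\<in>I. P v x \<and> f v x \<in> U i) \<and>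
      (\<forall>v\<in>I. \<forall>w\<in>I. P v x \<and> f v x \<in> U i \<and> P w x \<and> f w x \<in> U i \<longrightarrow> f v x = f w x))"
      using I by measurable
    moreover have "(\<exists>m. C x \<inter> U i = {m}) \<longleftrightarrow> (\<exists>v\<in>I. P v x \<and> f v x \<in> U i) \<and>
      (\<forall>v\<in>I. \<forall>w\<in>I. P v x \<and> f v x \<in> U i \<and> P w x \<and> f w x \<in> U i \<longrightarrow> f v x = f w x)" (is "?l = ?r")
      if x: "x \<in> space M" for x
    proof
      assume ?l
      then obtain m where "C x \<inter> U i = {m}" by blast
      then have *: "y \<in> C x \<and> y \<in> U i \<longleftrightarrow> y = m" for y by blast
      have m: "m \<in> C x" "m \<in> U i" using *[of m] by simp_all
      obtain v where v: "v \<in> I" "P v x" "f v x = m" using m(1) C[OF x] by auto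
      have uniq: "f w x = m" if "w \<in> I" "P w x" "f w x \<in> U i" for w
        using *[of "f w x"] that C[OF x] by blast
      have "\<exists>v\<in>I. P v x \<and> f v x \<in> U i" using v m(2) by blast
      then show ?r by (metis uniq)
    next
      assume ?r
      then obtain v where v: "v \<in> I" "P v x" "f v x \<in> U i" by blast
      have "f w x = f v x" if "w \<in> I" "P w x" "f w x \<in> U i" for w
        using \<open>?r\<close> v that by blast
      then have "C x \<inter> U i = {f v x}" unfolding C[OF x] using v by blast
      then show ?l by blast
    qed
    ultimately show ?thesis by (simp cong: measurable_cong)
  qed
  then have [measurable]: "L \<in> M \<rightarrow>\<^sub>M count_space UNIV"
    unfolding L_def by measurable
  have "r -` A \<inter> space M \<in> sets M" if A [measurable]: "A \<in> sets M" for A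
  proof -
    have "Measurable.pred M (\<lambda>x. \<exists>v\<in>I. P v x \<and> f v x \<in> U i \<and> f v x \<in> A)" for i
      using I by measurable
    then have "Measurable.pred M (\<lambda>x. (\<lambda>i x. \<exists>v\<in>I. P v x \<and> f v x \<in> U i \<and> f v x \<in> A) (L x) x)"
      by (rule measurable_compose_countable) measurable
    then have "{x \<in> space M. \<exists>v\<in>I. P v x \<and> f v x \<in> U (L x) \<and> f v x \<in> A} \<in> sets M"
      by (simp add: pred_def)
    moreover have "(\<exists>v\<in>I. P v x \<and> f v x \<in> U (L x) \<and> f v x \<in> A) \<longleftrightarrow> r x \<in> A" if x: "x \<in> space M" for x
    proof -
      have *: "y \<in> C x \<and> y \<in> U (L x) \<longleftrightarrow> y = r x" for y using r[OF x] by blast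
      have "(\<exists>v\<in>I. P v x \<and> f v x \<in> U (L x) \<and> f v x \<in> A) \<longleftrightarrow> (\<exists>y\<in>C x. y \<in> U (L x) \<and> y \<in> A)"
        unfolding C[OF x] by blast
      with * show ?thesis by metis
    qed
    ultimately show ?thesis by (simp add: vimage_def Int_def conj_commute cong: conj_cong)
  qed
  moreover have rC: "\<And>x. x \<in> space M \<Longrightarrow> r x \<in> C x" using r by blast
  ultimately have rM: "r \<in> M \<rightarrow>\<^sub>M M"
    by (intro measurableI) (use rC C_space in blast)+
  have "\<And>x y. C x = C y \<Longrightarrow> r x = r y" by (simp add: r_def L_def)
  with rM rC show thesis by (rule that)
qed

lemma graph_measurable:
  assumes I: "countable I" and f: "\<And>v. v \<in> I \<Longrightarrow> f v \<in> M \<rightarrow>\<^sub>M M"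
  shows "{(x, f v x) | x v. x \<in> space M \<and> v \<in> I} \<in> sets (M \<Otimes>\<^sub>M M)"
proof -
  note [measurable] = f
  have [measurable]: "Measurable.pred (M \<Otimes>\<^sub>M M) (\<lambda>p. f v (fst p) = snd p)" if "v \<in> I" for v
    using that by (intro measurable_eq_pred) measurable
  have "{p \<in> space (M \<Otimes>\<^sub>M M). \<exists>v\<in>I. f v (fst p) = snd p} \<in> sets (M \<Otimes>\<^sub>M M)"
    using I by measurable
  also have "{p \<in> space (M \<Otimes>\<^sub>M M). \<exists>v\<in>I. f v (fst p) = snd p} = {(x, f v x) | x v. x \<in> space M \<and> v \<in> I}"
    using measurable_space[OF f] by (auto simp: space_pair_measure)
  finally show ?thesis .
qed

lemma kernel_measurable:
  assumes [measurable]: "r \<in> M \<rightarrow>\<^sub>M M"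
  shows "{p \<in> space (M \<Otimes>\<^sub>M M). r (fst p) = r (snd p)} \<in> sets (M \<Otimes>\<^sub>M M)"
  using measurable_eq_pred[of "\<lambda>p. r (fst p)" "M \<Otimes>\<^sub>M M" "\<lambda>p. r (snd p)"] by (simp add: pred_def)

end

lemma standard_borel_separating_sequence:
  assumes "standard_borel M"
  obtains U where "separating_sequence M U"
proof -
  obtain T where T: "topspace T = space M" "completely_metrizable_space T" "second_countable T"
    and sets: "sets M = sigma_sets (space M) {U. openin T U}"
    using assms unfolding standard_borel_def by blast
  obtain B where B: "countable B" "\<And>V. V \<in> B \<Longrightarrow> openin T V"
      "\<And>W x. openin T W \<Longrightarrow> x \<in> W \<Longrightarrow> \<exists>V\<in>B. x \<in> V \<and> V \<subseteq> W"
    using T(3) unfolding second_countable_def by metis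
  have haus: "Hausdorff_space T"
    using T(2) by (simp add: completely_metrizable_imp_metrizable_space metrizable_imp_Hausdorff_space)
  define U where "U = from_nat_into (insert {} B)"
  have rU: "range U = insert {} B"
    unfolding U_def using B(1) by (intro range_from_nat_into) auto
  have "openin T (U i)" for i
    using rU B(2) by (metis insertE openin_empty rangeI)
  then have "U i \<in> sets M" for i
    unfolding sets by (intro sigma_sets.Basic) simp
  moreover have "\<exists>i. x \<in> U i \<and> U i \<inter> F = {}" if F: "finite F" "F \<subseteq> space M" "x \<in> space M - F" for F x
  proof -
    have "closedin T F"
      using haus F T(1) by (metis Hausdorff_imp_t1_space t1_space_closedin_finite)
    then have "openin T (space M - F)" using T(1) by (metis openin_diff openin_topspace)
    then obtain V where "V \<in> B" "x \<in> V" "V \<subseteq> space M - F" using B(3) F(3) by blast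
    then show ?thesis using rU by (metis Diff_disjoint Int_commute disjoint_iff insertI2 rangeE subsetD)
  qed
  ultimately show thesis by (intro that[of U]) (unfold_locales, auto)
qed

section \<open>Squares in $\mathbb{Z}^2$\<close>

definition square :: "int \<Rightarrow> (int \<times> int) set" where
  "square N = {-N..N} \<times> {-N..N}"

lemma finite_square [simp]: "finite (square N)"
  by (simp add: square_def)

lemma square_0 [simp]: "0 \<in> square N \<longleftrightarrow> 0 \<le> N"
  by (auto simp: square_def zero_prod_def)

lemma square_add: "v \<in> square N \<Longrightarrow> w \<in> square k \<Longrightarrow> v + w \<in> square (N + k)"
  and square_diff: "v \<in> square N \<Longrightarrow> w \<in> square k \<Longrightarrow> v - w \<in> square (N + k)"
  by (auto simp: square_def)

lemma square_uminus: "v \<in> square N \<Longrightarrow> - v \<in> square N"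
  by (auto simp: square_def)

lemma square_mono: "N \<le> N' \<Longrightarrow> square N \<subseteq> square N'"
  by (auto simp: square_def)

lemma square_ex: obtains k where "0 \<le> k" "v \<in> square k"
  by (rule that[of "max \<bar>fst v\<bar> \<bar>snd v\<bar>"]) (auto simp: square_def mem_Times_iff)

text \<open>
  The shell has about \<open>16 k N\<close> points while the square \<open>{0..N} \<times> {0..N}\<close> has about \<open>N\<^sup>2\<close>. This
  Foelner property is where the amenability of \<open>\<int>\<^sup>2\<close> enters.
\<close>
lemma card_shell:
  assumes "0 \<le> k" "k \<le> N"
  shows "real (card (square (N + k) - square (N - k))) = of_int (8 * k * (2 * N + 1))"
proof -
  have card_square: "real (card (square n)) = of_int ((2 * n + 1)\<^sup>2)" if "n \<ge> 0" for n
    using that by (simp add: square_def card_cartesian_product power2_eq_square)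
  have sub: "square (N - k) \<subseteq> square (N + k)" using assms by (intro square_mono) simp
  have "real (card (square (N + k) - square (N - k))) = real (card (square (N + k))) - real (card (square (N - k)))"
    using sub by (simp add: card_Diff_subset card_mono of_nat_diff)
  also have "\<dots> = of_int ((2 * (N + k) + 1)\<^sup>2 - (2 * (N - k) + 1)\<^sup>2)"
    using assms by (simp add: card_square)
  also have "(2 * (N + k) + 1)\<^sup>2 - (2 * (N - k) + 1)\<^sup>2 = 8 * k * (2 * N + 1)"
    by (simp add: power2_eq_square algebra_simps)
  finally show ?thesis .
qed

section \<open>Null and hyperfinite relations\<close>

lemma rel_measure_eq_0:
  assumes "AE x in M. {y. (x, y) \<in> F} = {}"
  shows "rel_measure M F = 0"
proof -
  have "rel_measure M F = (\<integral>\<^sup>+ x. 0 \<partial>M)"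
    unfolding rel_measure_def using assms by (intro nn_integral_cong_AE) (auto elim!: eventually_mono)
  then show ?thesis by simp
qed

lemma rel_measure_mono: "F \<subseteq> F' \<Longrightarrow> rel_measure M F \<le> rel_measure M F'"
  unfolding rel_measure_def by (intro nn_integral_mono emeasure_mono) auto

text \<open>
  The fibre of \<open>F\<close> over \<open>x\<close> has at least one element whenever \<open>(x, g x) \<in> F\<close>, so the measure of \<open>F\<close> bounds
  the measure of the set of those \<open>x\<close>.
\<close>
lemma rel_measure_null_graph:
  assumes F [measurable]: "F \<in> sets (M \<Otimes>\<^sub>M M)" and null: "rel_measure M F = 0"
    and g [measurable]: "g \<in> M \<rightarrow>\<^sub>M M"
  shows "AE x in M. (x, g x) \<notin> F"
proof -
  have "emeasure M {x \<in> space M. (x, g x) \<in> F} = (\<integral>\<^sup>+ x. indicator {x \<in> space M. (x, g x) \<in> F} x \<partial>M)"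
    by simp
  also have "\<dots> \<le> rel_measure M F"
    unfolding rel_measure_def
  proof (rule nn_integral_mono)
    fix x
    show "indicator {x \<in> space M. (x, g x) \<in> F} x \<le> emeasure (count_space UNIV) {y. (x, y) \<in> F}"
    proof (cases "(x, g x) \<in> F")
      case True
      then have "emeasure (count_space UNIV) {g x} \<le> emeasure (count_space UNIV) {y. (x, y) \<in> F}"
        by (intro emeasure_mono) auto
      then show ?thesis by (simp add: indicator_def)
    qed simp
  qed
  finally have "emeasure M {x \<in> space M. (x, g x) \<in> F} = 0" using null by simp
  then show ?thesis by (subst AE_iff_measurable[OF _ refl]) auto
qed

lemma subeq_rel_Int:
  assumes "subeq_rel M R S" "subeq_rel M R' T"
  shows "subeq_rel M S (T \<inter> S)"
  using assms unfolding subeq_rel_def equiv_def refl_on_def by (auto intro: sym_Int trans_Int)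

text \<open>Intersecting a finite exhaustion of \<open>S\<close> with \<open>S'\<close> gives a finite exhaustion of \<open>S'\<close>.\<close>
lemma hyperfinite_subrelation:
  assumes S: "hyperfinite_rel M S" and S': "subeq_rel M S S'"
  shows "hyperfinite_rel M S'"
proof -
  obtain T :: "nat \<Rightarrow> ('a \<times> 'a) set"
    where T: "\<And>n. subeq_rel M S (T n)" "\<And>n. T n \<subseteq> T (Suc n)" "\<And>n x. x \<in> space M \<Longrightarrow> finite (T n `` {x})"
      "eq_mod_null M S (\<Union>n. T n)"
    using S unfolding hyperfinite_rel_def by blast
  have "sym_diff S' (\<Union>n. T n \<inter> S') \<subseteq> sym_diff S (\<Union>n. T n)"
    using S' T(1) unfolding subeq_rel_def by blast
  then have "rel_measure M (sym_diff S' (\<Union>n. T n \<inter> S')) = 0"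
    using T(4) rel_measure_mono unfolding eq_mod_null_def by (metis le_zero_eq)
  moreover have "subeq_rel M S' (T n \<inter> S')" for n
    by (rule subeq_rel_Int[OF S' T(1)])
  moreover have "finite ((T n \<inter> S') `` {x})" if "x \<in> space M" for n x
    by (rule finite_subset[OF _ T(3)[OF that]]) auto
  ultimately show ?thesis
    unfolding hyperfinite_rel_def eq_mod_null_def using T(2)
    by (intro exI[of _ "\<lambda>n. T n \<inter> S'"]) blast
qed

section \<open>Hyperfiniteness of free actions of $\mathbb{Z}^2$\<close>

locale plane_action = separating_sequence M U + prob_space M for M :: "'a measure" and U +
  fixes \<psi> :: "int \<times> int \<Rightarrow> 'a \<Rightarrow> 'a"
  assumes act_measurable [measurable]: "\<And>v. \<psi> v \<in> M \<rightarrow>\<^sub>M M"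
    and act_distr: "\<And>v. distr M M (\<psi> v) = M"
    and act_zero: "\<And>x. x \<in> space M \<Longrightarrow> \<psi> 0 x = x"
    and act_add: "\<And>v w x. x \<in> space M \<Longrightarrow> \<psi> (v + w) x = \<psi> v (\<psi> w x)"
    and act_free: "AE x in M. \<forall>v. \<psi> v x = x \<longrightarrow> v = 0"
begin

lemma act_space: "x \<in> space M \<Longrightarrow> \<psi> v x \<in> space M"
  using measurable_space[OF act_measurable] .

lemma act_shift: "x \<in> space M \<Longrightarrow> \<psi> v x = \<psi> (v - w) (\<psi> w x)"
  by (metis act_add diff_add_cancel)

lemma act_inverse: "x \<in> space M \<Longrightarrow> \<psi> (- v) (\<psi> v x) = x"
  by (metis act_add act_zero add.left_inverse)

lemma prob_preimage:
  assumes "A \<in> sets M"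
  shows "prob {x \<in> space M. \<psi> v x \<in> A} = prob A"
proof -
  have "prob A = measure (distr M M (\<psi> v)) A" by (simp add: act_distr)
  also have "\<dots> = prob {x \<in> space M. \<psi> v x \<in> A}"
    using assms by (subst measure_distr) (auto simp: vimage_def Int_def conj_commute)
  finally show ?thesis ..
qed

definition plane_orbits :: "(int \<times> int) set \<Rightarrow> ('a \<times> 'a) set" where
  "plane_orbits H = {(x, \<psi> v x) | x v. x \<in> space M \<and> v \<in> H}"

lemma subeq_orbits:
  assumes "0 \<in> H" "\<And>v w. v \<in> H \<Longrightarrow> w \<in> H \<Longrightarrow> v - w \<in> H" "plane_orbits H \<subseteq> R"
  shows "subeq_rel M R (plane_orbits H)"
proof -
  have "plane_orbits H \<in> sets (M \<Otimes>\<^sub>M M)"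
    unfolding plane_orbits_def by (intro graph_measurable) (auto intro: countable_subset[OF subset_UNIV])
  moreover have "equiv (space M) (plane_orbits H)"
  proof (rule equivI)
    show "plane_orbits H \<subseteq> space M \<times> space M" by (auto simp: plane_orbits_def act_space)
    show "refl_on (space M) (plane_orbits H)"
    proof (unfold refl_on_def, rule ballI)
      fix x assume x: "x \<in> space M"
      then have "(x, \<psi> 0 x) \<in> plane_orbits H" using assms(1) unfolding plane_orbits_def by blast
      with x show "(x, x) \<in> plane_orbits H" by (simp add: act_zero)
    qed
    have um: "- v \<in> H" if "v \<in> H" for v using assms(1) assms(2)[of 0 v] that by simp
    show "sym (plane_orbits H)"
    proof (rule symI)
      fix x y assume "(x, y) \<in> plane_orbits H"
      then obtain v where v: "x \<in> space M" "v \<in> H" "y = \<psi> v x" by (auto simp: plane_orbits_def)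
      then have "x = \<psi> (- v) y" by (simp add: act_inverse)
      moreover have "y \<in> space M" "- v \<in> H" using v um by (simp_all add: act_space)
      ultimately show "(y, x) \<in> plane_orbits H" unfolding plane_orbits_def by blast
    qed
    show "trans (plane_orbits H)"
    proof (rule transI)
      fix x y z assume "(x, y) \<in> plane_orbits H" "(y, z) \<in> plane_orbits H"
      then obtain v w where v: "x \<in> space M" "v \<in> H" "y = \<psi> v x" "w \<in> H" "z = \<psi> w y"
        by (auto simp: plane_orbits_def)
      then have "z = \<psi> (w - - v) x" by (simp add: act_add)
      then show "(x, z) \<in> plane_orbits H"
        using v(1) assms(2)[OF v(4) um[OF v(2)]] unfolding plane_orbits_def by blast
    qed
  qed
  ultimately show ?thesis using assms(3) by (simp add: subeq_rel_def)
qed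

lemma aperiodic_orbits:
  assumes "infinite H"
  shows "aperiodic_rel M (plane_orbits H)"
proof -
  have "AE x in M. infinite (plane_orbits H `` {x})"
    using act_free AE_space
  proof eventually_elim
    fix x assume x: "\<forall>v. \<psi> v x = x \<longrightarrow> v = 0" "x \<in> space M"
    have "inj_on (\<lambda>v. \<psi> v x) H"
    proof (rule inj_onI)
      fix v w assume "\<psi> v x = \<psi> w x"
      then have "\<psi> (- w + v) x = x" using x(2) by (simp only: act_add act_inverse)
      then have "- w + v = 0" using x(1) by blast
      then show "v = w" by simp
    qed
    moreover have "plane_orbits H `` {x} = (\<lambda>v. \<psi> v x) ` H"
      using x(2) by (auto simp: plane_orbits_def)
    ultimately show "infinite (plane_orbits H `` {x})" using assms by (simp add: finite_image_iff)
  qed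
  then show ?thesis by (simp add: aperiodic_rel_def)
qed

text \<open>
  Removing from \<open>U i\<close> every point with a \<open>K\<close>-translate in \<open>U i\<close> leaves a separated set. These sets still
  cover: at a point with free orbit, some \<open>U i\<close> contains the point and none of its finitely many
  nontrivial \<open>K\<close>-translates.
\<close>
lemma separated_cover:
  assumes K: "finite K"
  obtains V :: "nat \<Rightarrow> 'a set" where "\<And>i. V i \<in> sets M"
    "\<And>i x k. x \<in> V i \<Longrightarrow> k \<in> K \<Longrightarrow> k \<noteq> 0 \<Longrightarrow> \<psi> k x \<notin> V i" "AE x in M. \<exists>i. x \<in> V i"
proof -
  define V where "V i = {x \<in> space M. x \<in> U i \<and> (\<forall>k\<in>K - {0}. \<psi> k x \<notin> U i)}" for i
  have "V i \<in> sets M" for i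
    unfolding V_def by measurable
  moreover have "\<psi> k x \<notin> V i" if "x \<in> V i" "k \<in> K" "k \<noteq> 0" for i x k
    using that by (auto simp: V_def)
  moreover have "AE x in M. \<exists>i. x \<in> V i"
    using act_free AE_space
  proof eventually_elim
    fix x assume x: "\<forall>v. \<psi> v x = x \<longrightarrow> v = 0" "x \<in> space M"
    have "\<exists>i. x \<in> U i \<and> U i \<inter> (\<lambda>k. \<psi> k x) ` (K - {0}) = {}"
      using K x by (intro separates) (auto simp: act_space)
    then obtain i where i: "x \<in> U i" "U i \<inter> (\<lambda>k. \<psi> k x) ` (K - {0}) = {}" by blast
    then have "x \<in> V i" using x(2) unfolding V_def by blast
    then show "\<exists>i. x \<in> V i" ..
  qed
  ultimately show thesis by (rule that)
qed

text \<open>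
  A maximal separated set of markers, built greedily: run through a cover by separated sets and add
  at each stage the points that have no marker nearby yet. Maximality means that almost every point
  has a marker within distance \<open>N\<close>.
\<close>
lemma maximal_separated_set:
  assumes N: "0 \<le> N"
  obtains B where "B \<in> sets M" "\<And>x k. x \<in> B \<Longrightarrow> k \<in> square N \<Longrightarrow> k \<noteq> 0 \<Longrightarrow> \<psi> k x \<notin> B"
    "AE x in M. \<exists>k\<in>square N. \<psi> k x \<in> B"
proof -
  obtain V :: "nat \<Rightarrow> 'a set" where V [measurable]: "\<And>i. V i \<in> sets M"
    and sep: "\<And>i x k. x \<in> V i \<Longrightarrow> k \<in> square N \<Longrightarrow> k \<noteq> 0 \<Longrightarrow> \<psi> k x \<notin> V i"
    and cover: "AE x in M. \<exists>i. x \<in> V i"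
    using separated_cover[of "square N"] by auto
  define D where "D = rec_nat {} (\<lambda>n D. D \<union> {x \<in> space M. x \<in> V n \<and> (\<forall>k\<in>square N. \<psi> k x \<notin> D)})"
  have D0: "D 0 = {}"
    and DS: "\<And>n. D (Suc n) = D n \<union> {x \<in> space M. x \<in> V n \<and> (\<forall>k\<in>square N. \<psi> k x \<notin> D n)}"
    by (simp_all add: D_def)
  have D [measurable]: "D n \<in> sets M" for n
  proof (induction n)
    case (Suc n)
    note [measurable] = this
    show ?case unfolding DS by measurable
  qed (simp add: D0)
  have Dspace: "D n \<subseteq> space M" for n using D sets.sets_into_space by blast
  have mono: "D i \<subseteq> D j" if "i \<le> j" for i j
    by (rule lift_Suc_mono_le[OF _ that]) (simp add: DS)
  have Dsep: "\<psi> k x \<notin> D n" if "x \<in> D n" "k \<in> square N" "k \<noteq> 0" for n x k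
    using that
  proof (induction n arbitrary: x k)
    case (Suc n)
    have x: "x \<in> space M" using Suc.prems Dspace by blast
    show ?case
    proof
      assume y: "\<psi> k x \<in> D (Suc n)"
      have undo: "\<psi> (- k) (\<psi> k x) = x" "- k \<in> square N"
        by (rule act_inverse[OF x]) (rule square_uminus[OF Suc.prems(2)])
      show False
      proof (cases "x \<in> D n")
        case True
        then have "\<psi> k x \<notin> D n" using Suc by blast
        then have "\<forall>j\<in>square N. \<psi> j (\<psi> k x) \<notin> D n" using y unfolding DS by blast
        then show False using undo True by metis
      next
        case False
        then have "x \<in> V n" "\<forall>j\<in>square N. \<psi> j x \<notin> D n" using Suc.prems unfolding DS by blast+
        then have "\<psi> k x \<notin> D n" "\<psi> k x \<notin> V n" using sep Suc.prems by blast+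
        then show False using y unfolding DS by blast
      qed
    qed
  qed (simp add: D0)
  define B where "B = (\<Union>n. D n)"
  have "B \<in> sets M" unfolding B_def by measurable
  moreover have "\<psi> k x \<notin> B" if x: "x \<in> B" and k: "k \<in> square N" "k \<noteq> 0" for x k
  proof
    assume "\<psi> k x \<in> B"
    then obtain i j where "x \<in> D i" "\<psi> k x \<in> D j" using x by (auto simp: B_def)
    then have "x \<in> D (max i j)" "\<psi> k x \<in> D (max i j)"
      using mono[of i "max i j"] mono[of j "max i j"] by auto
    then show False using Dsep k by blast
  qed
  moreover have "AE x in M. \<exists>k\<in>square N. \<psi> k x \<in> B"
    using cover AE_space
  proof eventually_elim
    fix x assume x: "\<exists>i. x \<in> V i" "x \<in> space M"
    then obtain n where n: "x \<in> V n" by blast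
    show "\<exists>k\<in>square N. \<psi> k x \<in> B"
    proof (cases "\<exists>k\<in>square N. \<psi> k x \<in> D n")
      case True
      then show ?thesis by (auto simp: B_def)
    next
      case False
      then have "\<psi> 0 x \<in> D (Suc n)" using n x by (auto simp: DS act_zero)
      then show ?thesis using N unfolding B_def by (intro bexI[of _ 0]) auto
    qed
  qed
  ultimately show thesis by (rule that)
qed

text \<open>
  Separation makes the \<open>(N + 1)\<^sup>2\<close> translates of \<open>B\<close> by \<open>{0..N} \<times> {0..N}\<close> disjoint, because differences
  of elements of this smaller square lie in \<open>square N\<close>.
\<close>
lemma separated_set_measure:
  assumes B [measurable]: "B \<in> sets M" and N: "0 \<le> N"
    and sep: "\<And>x k. x \<in> B \<Longrightarrow> k \<in> square N \<Longrightarrow> k \<noteq> 0 \<Longrightarrow> \<psi> k x \<notin> B"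
  shows "of_int (N + 1) ^ 2 * prob B \<le> 1"
proof -
  define Q where "Q = {0..N} \<times> {0..N}"
  define S where "S v = {x \<in> space M. \<psi> v x \<in> B}" for v
  have "disjoint_family_on S Q"
    unfolding disjoint_family_on_def
  proof (intro ballI impI)
    fix v w assume vw: "v \<in> Q" "w \<in> Q" "v \<noteq> w"
    have "w - v \<in> square N" "w - v \<noteq> 0" using vw by (auto simp: Q_def square_def)
    then have "\<psi> w x \<notin> B" if "\<psi> v x \<in> B" "x \<in> space M" for x
      using sep[OF that(1)] act_shift[OF that(2), of w v] by metis
    then show "S v \<inter> S w = {}" by (auto simp: S_def)
  qed
  then have "prob (\<Union>v\<in>Q. S v) = (\<Sum>v\<in>Q. prob (S v))"
    by (rule finite_measure_finite_Union[rotated 2]) (auto simp: S_def Q_def)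
  also have "\<dots> = of_int (N + 1) ^ 2 * prob B"
    using N by (simp add: S_def prob_preimage[OF B] Q_def card_cartesian_product power2_eq_square)
  finally show ?thesis by (metis prob_le_1)
qed

text \<open>
  Almost every point selects one of the markers within distance \<open>N\<close>, and the tiles are the sets of points
  of an orbit with the same selected marker. The selection depends only on the set of markers in
  view, so \<open>x\<close> and \<open>\<psi> w x\<close> can be separated only if some marker is visible from one of them and not
  from the other. Such a marker is \<open>\<psi> v x\<close> with \<open>v\<close> in a shell of width about \<open>2 k\<close> around the
  boundary of the square. The shell has at most \<open>16 k (N + 1)\<close> points and the marker set has measure at
  most \<open>1 / (N + 1)\<^sup>2\<close>, which gives the bound.
\<close>
lemma finite_tiling:
  assumes N: "0 \<le> N"
  obtains T where "subeq_rel M (plane_orbits UNIV) T" "\<And>x. x \<in> space M \<Longrightarrow> finite (T `` {x})"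
    "\<And>w k. 0 \<le> k \<Longrightarrow> k \<le> N \<Longrightarrow> w \<in> square k \<Longrightarrow>
       prob {x \<in> space M. (x, \<psi> w x) \<notin> T} \<le> 16 * of_int k / of_int (N + 1)"
proof -
  obtain B where B [measurable]: "B \<in> sets M"
    and sep: "\<And>x k. x \<in> B \<Longrightarrow> k \<in> square N \<Longrightarrow> k \<noteq> 0 \<Longrightarrow> \<psi> k x \<notin> B"
    and cover: "AE x in M. \<exists>k\<in>square N. \<psi> k x \<in> B"
    using maximal_separated_set[OF N] by blast
  \<comment> \<open>The second disjunct makes a point without visible markers its own candidate, so that the
    candidate set \<open>C x\<close> is never empty.\<close>
  define P where "P v x \<longleftrightarrow> \<psi> v x \<in> B \<or> v = 0 \<and> (\<forall>w\<in>square N. \<psi> w x \<notin> B)" for v x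
  define C where "C x = {\<psi> v x | v. v \<in> square N \<and> P v x}" for x
  have C_ne: "C x \<noteq> {}" for x
  proof (cases "\<exists>w\<in>square N. \<psi> w x \<in> B")
    case True
    then show ?thesis by (auto simp: C_def P_def)
  next
    case False
    then have "P 0 x" by (auto simp: P_def)
    then have "\<psi> 0 x \<in> C x" using N unfolding C_def by (intro CollectI exI[of _ 0]) simp
    then show ?thesis by blast
  qed
  have P: "Measurable.pred M (P v)" for v
    unfolding P_def by measurable
  have C_fin: "finite (C x)" for x
    by (rule finite_subset[of _ "(\<lambda>v. \<psi> v x) ` square N"]) (auto simp: C_def)
  obtain r where r [measurable]: "r \<in> M \<rightarrow>\<^sub>M M" and rC: "\<And>x. x \<in> space M \<Longrightarrow> r x \<in> C x"
    and rcong: "\<And>x y. C x = C y \<Longrightarrow> r x = r y"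
  proof (rule measurable_selection[where I = "square N" and f = \<psi> and P = P and C = C])
    show "countable (square N)" by (simp add: countable_finite)
    show "C x = {\<psi> v x | v. v \<in> square N \<and> P v x}" for x by (rule C_def)
  next
    fix r assume "r \<in> M \<rightarrow>\<^sub>M M" "\<And>x. x \<in> space M \<Longrightarrow> r x \<in> C x" "\<And>x y. C x = C y \<Longrightarrow> r x = r y"
    then show thesis by (rule that)
  qed (rule act_measurable P C_fin C_ne)+
  define T where "T = plane_orbits UNIV \<inter> {p \<in> space (M \<Otimes>\<^sub>M M). r (fst p) = r (snd p)}"
  have T_iff: "(x, y) \<in> T \<longleftrightarrow> (x, y) \<in> plane_orbits UNIV \<and> x \<in> space M \<and> y \<in> space M \<and> r x = r y" for x y
    by (auto simp: T_def space_pair_measure)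
  have orb: "subeq_rel M (plane_orbits UNIV) (plane_orbits UNIV)"
    by (rule subeq_orbits) auto
  have sub: "subeq_rel M (plane_orbits UNIV) T"
    unfolding subeq_rel_def
  proof (intro conjI)
    show "T \<in> sets (M \<Otimes>\<^sub>M M)"
      unfolding T_def using orb by (intro sets.Int kernel_measurable r) (simp add: subeq_rel_def)
    show "T \<subseteq> plane_orbits UNIV" by (auto simp: T_def)
    have eq: "equiv (space M) (plane_orbits UNIV)" using orb by (simp add: subeq_rel_def)
    show "equiv (space M) T"
    proof (rule equivI)
      show "T \<subseteq> space M \<times> space M" using T_iff by auto
      show "refl_on (space M) T" using eq by (auto simp: equiv_def refl_on_def T_iff)
      show "sym T" using eq unfolding equiv_def by (intro symI) (auto simp: T_iff dest: symD)
      show "trans T" using eq unfolding equiv_def by (intro transI) (auto simp: T_iff dest: transD)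
    qed
  qed
  have fin: "finite (T `` {x})" if x: "x \<in> space M" for x
  proof -
    have "T `` {x} \<subseteq> (\<lambda>v. \<psi> (- v) (r x)) ` square N"
    proof
      fix y assume "y \<in> T `` {x}"
      then have y: "y \<in> space M" "r y = r x" using T_iff by auto
      then obtain v where "v \<in> square N" "r x = \<psi> v y" using rC[of y] by (auto simp: C_def)
      then show "y \<in> (\<lambda>v. \<psi> (- v) (r x)) ` square N"
        using y(1) by (auto simp: act_inverse intro!: image_eqI[of _ _ v])
    qed
    then show ?thesis by (rule finite_subset) simp
  qed
  have bad: "prob {x \<in> space M. (x, \<psi> w x) \<notin> T} \<le> 16 * of_int k / of_int (N + 1)"
    if k: "0 \<le> k" "k \<le> N" and w: "w \<in> square k" for w k
  proof -
    define shell where "shell = square (N + k) - square (N - k)"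
    define E where "E = (\<Union>v\<in>shell. {x \<in> space M. \<psi> v x \<in> B})"
    have in_shell: "x \<in> E"
      if x: "x \<in> space M" and cov: "\<exists>j\<in>square N. \<psi> j x \<in> B" and nT: "(x, \<psi> w x) \<notin> T" for x
    proof (rule ccontr)
      assume "x \<notin> E"
      then have out: "v \<in> square (N - k)" if "\<psi> v x \<in> B" "v \<in> square (N + k)" for v
        using x that unfolding E_def shell_def by blast
      define Mk where "Mk z = {\<psi> v z | v. v \<in> square N \<and> \<psi> v z \<in> B}" for z
      have C_Mk: "C z = Mk z" if "Mk z \<noteq> {}" for z
        using that unfolding C_def Mk_def P_def by blast
      have "Mk x \<subseteq> Mk (\<psi> w x)"
      proof
        fix m assume "m \<in> Mk x"
        then obtain v where v: "v \<in> square N" "\<psi> v x \<in> B" "m = \<psi> v x" by (auto simp: Mk_def)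
        have "v \<in> square (N + k)" using v(1) square_mono[of N "N + k"] k by auto
        then have "v - w \<in> square N" using out[OF v(2)] square_diff[OF _ w, of v "N - k"] by simp
        moreover have m: "m = \<psi> (v - w) (\<psi> w x)" unfolding v(3) by (rule act_shift[OF x])
        moreover have "\<psi> (v - w) (\<psi> w x) \<in> B" unfolding m[symmetric] v(3) by (rule v(2))
        ultimately show "m \<in> Mk (\<psi> w x)" unfolding Mk_def by blast
      qed
      moreover have "Mk (\<psi> w x) \<subseteq> Mk x"
      proof
        fix m assume "m \<in> Mk (\<psi> w x)"
        then obtain v where v: "v \<in> square N" "m \<in> B" "m = \<psi> v (\<psi> w x)" by (auto simp: Mk_def)
        then have m: "m = \<psi> (v + w) x" using x by (simp add: act_add)
        have "v + w \<in> square (N - k)" 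
          by (rule out) (use v(2) m square_add[OF v(1) w] in simp_all)
        then have "v + w \<in> square N" using square_mono[of "N - k" N] k by auto
        moreover have "\<psi> (v + w) x \<in> B" unfolding m[symmetric] by (rule v(2))
        ultimately show "m \<in> Mk x" using m unfolding Mk_def by blast
      qed
      moreover have "Mk x \<noteq> {}" using cov by (auto simp: Mk_def)
      ultimately have "C x = C (\<psi> w x)" using C_Mk by (metis subset_antisym)
      then have "r x = r (\<psi> w x)" by (rule rcong)
      moreover have "(x, \<psi> w x) \<in> plane_orbits UNIV" using x unfolding plane_orbits_def by blast
      ultimately have "(x, \<psi> w x) \<in> T" using x by (simp add: T_iff act_space)
      with nT show False ..
    qed
    have [measurable]: "E \<in> sets M"
      unfolding E_def shell_def by measurable
    have "AE x in M. x \<in> {x \<in> space M. (x, \<psi> w x) \<notin> T} \<longrightarrow> x \<in> E"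
      using cover by (rule eventually_mono) (use in_shell in blast)
    then have "prob {x \<in> space M. (x, \<psi> w x) \<notin> T} \<le> prob E"
      by (rule finite_measure_mono_AE) measurable
    also have "\<dots> \<le> (\<Sum>v\<in>shell. prob {x \<in> space M. \<psi> v x \<in> B})"
      unfolding E_def by (rule measure_UNION_le) (simp_all add: shell_def)
    also have "\<dots> = of_int (8 * k * (2 * N + 1)) * prob B"
      using card_shell[OF k] by (simp add: prob_preimage[OF B] shell_def)
    also have "\<dots> \<le> of_int (8 * k * (2 * N + 2)) * prob B"
      using k N by (intro mult_right_mono) (simp_all add: mult_left_mono)
    also have "\<dots> = 16 * of_int k * (of_int (N + 1) ^ 2 * prob B) / of_int (N + 1)"
      using N by (simp add: power2_eq_square field_simps)
    also have "\<dots> \<le> 16 * of_int k * 1 / of_int (N + 1)"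
      using separated_set_measure[OF B N sep] k N by (intro divide_right_mono mult_left_mono) auto
    finally show ?thesis by simp
  qed
  show thesis by (rule that[OF sub fin bad])
qed

text \<open>
  The tilings for \<open>N = 2\<^sup>n\<close> are not nested, but their errors at a fixed \<open>w\<close> are summable. By
  Borel-Cantelli almost every \<open>x\<close> lies in one tile with \<open>\<psi> w x\<close> for all large \<open>n\<close>, so the
  intersections of the tails of the sequence of tilings form an increasing exhaustion.
\<close>
lemma hyperfinite_plane_orbits: "hyperfinite_rel M (plane_orbits UNIV)"
proof -
  let ?R = "plane_orbits UNIV"
  define tiling where "tiling n T \<longleftrightarrow> subeq_rel M ?R T \<and> (\<forall>x\<in>space M. finite (T `` {x})) \<and>
     (\<forall>w k. 0 \<le> k \<longrightarrow> k \<le> 2 ^ n \<longrightarrow> w \<in> square k \<longrightarrow>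
       prob {x \<in> space M. (x, \<psi> w x) \<notin> T} \<le> 16 * of_int k / of_int (2 ^ n + 1))" for n :: nat and T
  have "\<exists>T. tiling n T" for n
  proof -
    have N: "0 \<le> (2::int) ^ n" by simp
    obtain T where "subeq_rel M ?R T" "\<And>x. x \<in> space M \<Longrightarrow> finite (T `` {x})"
      "\<And>w k. 0 \<le> k \<Longrightarrow> k \<le> 2 ^ n \<Longrightarrow> w \<in> square k \<Longrightarrow>
         prob {x \<in> space M. (x, \<psi> w x) \<notin> T} \<le> 16 * of_int k / of_int (2 ^ n + 1)"
      by (rule finite_tiling[OF N], rule that)
    then show ?thesis unfolding tiling_def by (intro exI[of _ T] conjI ballI allI impI)
  qed
  then obtain T where "\<And>n. tiling n (T n)" by metis
  then have T: "\<And>n. subeq_rel M ?R (T n)" "\<And>n x. x \<in> space M \<Longrightarrow> finite (T n `` {x})"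
    and bad: "\<And>n w k. 0 \<le> k \<Longrightarrow> k \<le> 2 ^ n \<Longrightarrow> w \<in> square k \<Longrightarrow>
       prob {x \<in> space M. (x, \<psi> w x) \<notin> T n} \<le> 16 * of_int k / of_int (2 ^ n + 1)"
    unfolding tiling_def by blast+
  have Tm [measurable]: "T n \<in> sets (M \<Otimes>\<^sub>M M)" for n using T(1) by (simp add: subeq_rel_def)
  have ev: "AE x in M. eventually (\<lambda>n. (x, \<psi> w x) \<in> T n) sequentially" for w
  proof -
    obtain k where k: "0 \<le> k" "w \<in> square k" by (rule square_ex)
    define A where "A n = {x \<in> space M. (x, \<psi> w x) \<notin> T n}" for n
    have [measurable]: "A n \<in> sets M" for n unfolding A_def by measurable
    have "summable (\<lambda>n. prob (A n))"
    proof (rule summable_comparison_test_ev)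
      show "summable (\<lambda>n. 16 * of_int k * (1 / 2 :: real) ^ n)"
        by (intro summable_mult summable_geometric) simp
      \<comment> \<open>The error bound needs \<open>k \<le> 2\<^sup>n\<close>, which holds once \<open>k \<le> n\<close>.\<close>
      have "eventually (\<lambda>n. nat k \<le> n) sequentially" by (rule eventually_ge_at_top)
      then show "eventually (\<lambda>n. norm (prob (A n)) \<le> 16 * of_int k * (1 / 2) ^ n) sequentially"
      proof eventually_elim
        fix n assume "nat k \<le> n"
        then have "k \<le> int n" by simp
        also have "int n \<le> 2 ^ n" using less_exp[of n] by (metis less_imp_le of_nat_le_iff of_nat_numeral of_nat_power)
        finally have "prob (A n) \<le> 16 * of_int k / of_int (2 ^ n + 1)"
          unfolding A_def using k by (intro bad) auto
        also have "\<dots> \<le> 16 * of_int k / 2 ^ n"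
          using k by (intro divide_left_mono) (auto intro!: mult_pos_pos add_pos_pos)
        finally show "norm (prob (A n)) \<le> 16 * of_int k * (1 / 2) ^ n"
          by (simp add: power_one_over field_simps)
      qed
    qed
    then have "AE x in M. eventually (\<lambda>n. x \<in> space M - A n) sequentially"
      by (intro borel_cantelli_AE1) (auto simp: emeasure_eq_measure)
    then show ?thesis by (auto simp: A_def elim!: eventually_mono)
  qed
  define S where "S n = (\<Inter>m\<in>{n..}. T m)" for n
  have "subeq_rel M ?R (S n)" for n
    unfolding subeq_rel_def
  proof (intro conjI)
    show "S n \<in> sets (M \<Otimes>\<^sub>M M)"
      unfolding S_def by (intro sets.countable_INT') (auto intro: countable_subset[OF subset_UNIV])
    show "S n \<subseteq> ?R" using T(1) by (auto simp: S_def subeq_rel_def)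
    have e: "equiv (space M) (T m)" for m using T(1) by (simp add: subeq_rel_def)
    show "equiv (space M) (S n)"
    proof (rule equivI)
      show "S n \<subseteq> space M \<times> space M" using e unfolding S_def equiv_def by blast
      show "refl_on (space M) (S n)" using e unfolding S_def equiv_def refl_on_def by blast
      show "sym (S n)" using e unfolding S_def equiv_def by (intro symI) (blast dest: symD)
      show "trans (S n)" using e unfolding S_def equiv_def by (intro transI) (blast dest: transD)
    qed
  qed
  moreover have "S n \<subseteq> S (Suc n)" for n by (auto simp: S_def)
  moreover have "finite (S n `` {x})" if "x \<in> space M" for n x
    by (rule finite_subset[OF _ T(2)[OF that, of n]]) (auto simp: S_def)
  moreover have "eq_mod_null M ?R (\<Union>n. S n)"
    unfolding eq_mod_null_def
  proof (rule rel_measure_eq_0)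
    have "AE x in M. \<forall>w. eventually (\<lambda>n. (x, \<psi> w x) \<in> T n) sequentially"
      using ev by (simp only: AE_all_countable) simp
    then show "AE x in M. {y. (x, y) \<in> sym_diff ?R (\<Union>n. S n)} = {}"
    proof eventually_elim
      fix x assume x: "\<forall>w. eventually (\<lambda>n. (x, \<psi> w x) \<in> T n) sequentially"
      have "(x, y) \<in> (\<Union>n. S n)" if "(x, y) \<in> ?R" for y
      proof -
        obtain w where "y = \<psi> w x" using \<open>(x, y) \<in> ?R\<close> by (auto simp: plane_orbits_def)
        moreover obtain n where "\<forall>m\<ge>n. (x, \<psi> w x) \<in> T m"
          using x unfolding eventually_sequentially by blast
        ultimately have "(x, y) \<in> S n" by (simp add: S_def)
        then show ?thesis by blast
      qed
      moreover have "S n \<subseteq> ?R" for n using T(1)[of n] by (auto simp: S_def subeq_rel_def)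
      ultimately show "{y. (x, y) \<in> sym_diff ?R (\<Union>n. S n)} = {}" by blast
    qed
  qed
  ultimately show ?thesis unfolding hyperfinite_rel_def by blast
qed

end

section \<open>Ping-pong rules out hyperfiniteness\<close>

locale free_pmp_action = separating_sequence M U + prob_space M + group_action G "space M" \<phi>
  for M :: "'a measure" and U and G (structure) and \<phi> +
  assumes countable_carrier: "countable (carrier G)"
    and act_measurable: "\<And>g. g \<in> carrier G \<Longrightarrow> \<phi> g \<in> M \<rightarrow>\<^sub>M M"
    and act_distr: "\<And>g. g \<in> carrier G \<Longrightarrow> distr M M (\<phi> g) = M"
    and act_free: "AE x in M. stabilizer G \<phi> x = {\<one>}"
begin

lemma is_group: "group G"
  using group_hom group_hom.axioms(1) by blast

lemma act_space: "g \<in> carrier G \<Longrightarrow> x \<in> space M \<Longrightarrow> \<phi> g x \<in> space M"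
  using measurable_space[OF act_measurable] .

lemma act_one: "x \<in> space M \<Longrightarrow> \<phi> \<one> x = x"
  using fun_cong[OF id_eq_one, of x] by simp

lemma act_inv:
  assumes "g \<in> carrier G" "x \<in> space M"
  shows "\<phi> (inv g) (\<phi> g x) = x" "\<phi> g (\<phi> (inv g) x) = x"
  using assms is_group composition_rule[of x "inv g" g] composition_rule[of x g "inv g"]
  by (simp_all add: act_one group.l_inv group.r_inv group.inv_closed)

lemma prob_preimage:
  assumes "A \<in> sets M" "g \<in> carrier G"
  shows "prob {x \<in> space M. \<phi> g x \<in> A} = prob A"
proof -
  have "prob A = measure (distr M M (\<phi> g)) A" by (simp add: act_distr assms)
  also have "\<dots> = prob {x \<in> space M. \<phi> g x \<in> A}"
    using assms act_measurable by (subst measure_distr) (auto simp: vimage_def Int_def conj_commute)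
  finally show ?thesis ..
qed

text \<open>
  Give every class of \<open>T\<close> a root. By freeness a point of the class is \<open>f\<close> applied to its root for
  exactly one \<open>f\<close>, its coordinate, and \<open>Z D\<close> is the set of points with coordinate in \<open>D\<close>. If \<open>x\<close> and
  \<open>\<phi> a x\<close> share a class, their coordinates are \<open>f\<close> and \<open>a \<otimes> f\<close>, so the ping-pong hypothesis puts \<open>x\<close> in
  \<open>Z A'\<close> or \<open>\<phi> a x\<close> in \<open>Z A\<close>. As the action preserves the measure, this happens with probability at
  most that of \<open>Z A\<close> plus that of \<open>Z A'\<close>. The same holds for \<open>b\<close>, and the four sets are disjoint.
\<close>
lemma finite_relation_ping_pong:
  assumes T: "subeq_rel M (orbit_rel G M \<phi>) T" and fin: "\<And>x. x \<in> space M \<Longrightarrow> finite (T `` {x})"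
    and a: "a \<in> carrier G" and b: "b \<in> carrier G"
    and pp_a: "\<And>f. f \<in> carrier G \<Longrightarrow> f \<notin> A' \<Longrightarrow> a \<otimes> f \<in> A"
    and pp_b: "\<And>f. f \<in> carrier G \<Longrightarrow> f \<notin> B' \<Longrightarrow> b \<otimes> f \<in> B"
    and disj: "A \<inter> A' = {}" "(A \<union> A') \<inter> B = {}" "(A \<union> A' \<union> B) \<inter> B' = {}"
  shows "prob {x \<in> space M. (x, \<phi> a x) \<in> T} + prob {x \<in> space M. (x, \<phi> b x) \<in> T} \<le> 1"
proof -
  interpret G: group G by (rule is_group)
  have [measurable]: "T \<in> sets (M \<Otimes>\<^sub>M M)" and T_sub: "T \<subseteq> orbit_rel G M \<phi>"
    and eq: "equiv (space M) T"
    using T by (auto simp: subeq_rel_def)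
  note [measurable] = act_measurable
  obtain r where r [measurable]: "r \<in> M \<rightarrow>\<^sub>M M" and rT: "\<And>x. x \<in> space M \<Longrightarrow> r x \<in> T `` {x}"
    and rcong: "\<And>x y. T `` {x} = T `` {y} \<Longrightarrow> r x = r y"
  proof (rule measurable_selection[where I = "carrier G" and f = \<phi> and C = "\<lambda>x. T `` {x}"
        and P = "\<lambda>g x. (x, \<phi> g x) \<in> T"])
    show "T `` {x} = {\<phi> g x | g. g \<in> carrier G \<and> (x, \<phi> g x) \<in> T}" for x
      using T_sub by (auto simp: orbit_rel_def)
    show "T `` {x} \<noteq> {}" if "x \<in> space M" for x
      using eq that by (auto simp: equiv_def refl_on_def)
    show "Measurable.pred M (\<lambda>x. (x, \<phi> g x) \<in> T)" if "g \<in> carrier G" for g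
      using that by measurable
  next
    fix r assume "r \<in> M \<rightarrow>\<^sub>M M" "\<And>x. x \<in> space M \<Longrightarrow> r x \<in> T `` {x}"
      "\<And>x y. T `` {x} = T `` {y} \<Longrightarrow> r x = r y"
    then show thesis by (rule that)
  qed (rule countable_carrier act_measurable fin | assumption)+
  \<comment> \<open>Uniqueness of the coordinate is part of the definition, which makes these sets disjoint
    everywhere and not merely almost everywhere.\<close>
  define Z where "Z D = {x \<in> space M. \<exists>g\<in>carrier G. g \<in> D \<and> \<phi> g (r x) = x \<and>
     (\<forall>h\<in>carrier G. \<phi> h (r x) = x \<longrightarrow> h = g)}" for D
  have [measurable]: "Z D \<in> sets M" for D
  proof -
    have [measurable]: "Measurable.pred M (\<lambda>x. \<phi> g (r x) = x)" if "g \<in> carrier G" for g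
      by (rule measurable_eq_pred) (use that in measurable)
    show ?thesis unfolding Z_def using countable_carrier by measurable
  qed
  have Z_disj: "Z D \<inter> Z D' = {}" if "D \<inter> D' = {}" for D D'
    using that unfolding Z_def by blast
  have Z_Un: "Z (D \<union> D') = Z D \<union> Z D'" for D D'
    unfolding Z_def by blast
  have step: "prob {x \<in> space M. (x, \<phi> c x) \<in> T} \<le> prob (Z D) + prob (Z D')"
    if c: "c \<in> carrier G" and pp: "\<And>f. f \<in> carrier G \<Longrightarrow> f \<notin> D' \<Longrightarrow> c \<otimes> f \<in> D" for c D D'
  proof -
    have "AE x in M. x \<in> {x \<in> space M. (x, \<phi> c x) \<in> T} \<longrightarrow> x \<in> Z D' \<union> {x \<in> space M. \<phi> c x \<in> Z D}"
      using act_free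
    proof eventually_elim
      fix x assume stab: "stabilizer G \<phi> x = {\<one>}"
      show "x \<in> {x \<in> space M. (x, \<phi> c x) \<in> T} \<longrightarrow> x \<in> Z D' \<union> {x \<in> space M. \<phi> c x \<in> Z D}"
      proof
        assume "x \<in> {x \<in> space M. (x, \<phi> c x) \<in> T}"
        then have x: "x \<in> space M" and xc: "(x, \<phi> c x) \<in> T" by auto
        have "(x, r x) \<in> orbit_rel G M \<phi>" using rT[OF x] T_sub by auto
        then obtain k where k: "k \<in> carrier G" "r x = \<phi> k x" by (auto simp: orbit_rel_def)
        define g where "g = inv k"
        have g: "g \<in> carrier G" "\<phi> g (r x) = x" using k x by (simp_all add: g_def act_inv)
        have rx: "r x \<in> space M" using x measurable_space[OF r] by blast
        have uniq: "h = g" if h: "h \<in> carrier G" "\<phi> h (r x) = x" for h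
        proof -
          have "\<phi> (h \<otimes> k) x = x" using h k x by (simp add: composition_rule)
          then have "h \<otimes> k \<in> stabilizer G \<phi> x" using h k by (simp add: stabilizer_def)
          then have "h \<otimes> k = \<one>" using stab by simp
          then show "h = g" unfolding g_def using h(1) k(1) by (metis G.inv_equality)
        qed
        show "x \<in> Z D' \<union> {x \<in> space M. \<phi> c x \<in> Z D}"
        proof (cases "g \<in> D'")
          case True
          then show ?thesis using x g uniq unfolding Z_def by blast
        next
          case False
          have rc: "r (\<phi> c x) = r x"
            using rcong[of x "\<phi> c x"] equiv_class_eq[OF eq xc] by simp
          have cg: "\<phi> (c \<otimes> g) (r x) = \<phi> c x" using rx c g by (simp add: composition_rule)
          have uc: "h = c \<otimes> g" if h: "h \<in> carrier G" "\<phi> h (r x) = \<phi> c x" for h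
          proof -
            have "\<phi> (inv c \<otimes> h) (r x) = x" using h c rx x by (simp add: composition_rule act_inv)
            then have "inv c \<otimes> h = g" using uniq h c by simp
            then show ?thesis using h c by (metis G.inv_solve_left g(1))
          qed
          have D: "c \<otimes> g \<in> D" "c \<otimes> g \<in> carrier G" using pp[OF g(1) False] c g by auto
          have "\<phi> c x \<in> Z D"
            unfolding Z_def mem_Collect_eq rc using act_space[OF c x] cg uc D by blast
          then show ?thesis using x by blast
        qed
      qed
    qed
    then have "prob {x \<in> space M. (x, \<phi> c x) \<in> T} \<le> prob (Z D' \<union> {x \<in> space M. \<phi> c x \<in> Z D})"
      using c by (intro finite_measure_mono_AE) measurable
    also have "\<dots> \<le> prob (Z D') + prob {x \<in> space M. \<phi> c x \<in> Z D}"
      using c by (intro measure_Un_le) measurable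
    also have "\<dots> = prob (Z D) + prob (Z D')" using c by (simp add: prob_preimage)
    finally show ?thesis .
  qed
  have "prob {x \<in> space M. (x, \<phi> a x) \<in> T} \<le> prob (Z A) + prob (Z A')"
    by (rule step[OF a]) (rule pp_a)
  moreover have "prob {x \<in> space M. (x, \<phi> b x) \<in> T} \<le> prob (Z B) + prob (Z B')"
    by (rule step[OF b]) (rule pp_b)
  ultimately have "prob {x \<in> space M. (x, \<phi> a x) \<in> T} + prob {x \<in> space M. (x, \<phi> b x) \<in> T}
      \<le> prob (Z A) + prob (Z A') + prob (Z B) + prob (Z B')" by simp
  also have "\<dots> = prob (Z (A \<union> A' \<union> B \<union> B'))"
    using Z_disj[OF disj(1)] Z_disj[OF disj(2)] Z_disj[OF disj(3)]
    by (simp add: Z_Un finite_measure_Union)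
  also have "\<dots> \<le> 1" by simp
  finally show ?thesis .
qed

text \<open>
  Along an exhaustion of \<open>S\<close> by finite relations the probability that \<open>x\<close> is related to \<open>\<phi> a x\<close> tends
  to 1, and likewise for \<open>b\<close>. The sum of the two would tend to 2, yet it never exceeds 1.
\<close>
lemma ping_pong_not_hyperfinite:
  assumes S: "subeq_rel M (orbit_rel G M \<phi>) S" "hyperfinite_rel M S"
    and a: "a \<in> carrier G" "AE x in M. (x, \<phi> a x) \<in> S"
    and b: "b \<in> carrier G" "AE x in M. (x, \<phi> b x) \<in> S"
    and pp_a: "\<And>f. f \<in> carrier G \<Longrightarrow> f \<notin> A' \<Longrightarrow> a \<otimes> f \<in> A"
    and pp_b: "\<And>f. f \<in> carrier G \<Longrightarrow> f \<notin> B' \<Longrightarrow> b \<otimes> f \<in> B"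
    and disj: "A \<inter> A' = {}" "(A \<union> A') \<inter> B = {}" "(A \<union> A' \<union> B) \<inter> B' = {}"
  shows False
proof -
  obtain T :: "nat \<Rightarrow> ('a \<times> 'a) set"
    where T: "\<And>n. subeq_rel M S (T n)" "\<And>n. T n \<subseteq> T (Suc n)" "\<And>n x. x \<in> space M \<Longrightarrow> finite (T n `` {x})"
      and S_T: "eq_mod_null M S (\<Union>n. T n)"
    using S(2) unfolding hyperfinite_rel_def by blast
  have Tm [measurable]: "T n \<in> sets (M \<Otimes>\<^sub>M M)" for n using T(1) by (simp add: subeq_rel_def)
  have Sm [measurable]: "S \<in> sets (M \<Otimes>\<^sub>M M)" using S by (simp add: subeq_rel_def)
  have lim: "(\<lambda>n. prob {x \<in> space M. (x, \<phi> c x) \<in> T n}) \<longlonglongrightarrow> 1"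
    if c: "c \<in> carrier G" "AE x in M. (x, \<phi> c x) \<in> S" for c
  proof -
    have [measurable]: "\<phi> c \<in> M \<rightarrow>\<^sub>M M" by (rule act_measurable[OF c(1)])
    define A where "A n = {x \<in> space M. (x, \<phi> c x) \<in> T n}" for n
    have [measurable]: "A n \<in> sets M" for n unfolding A_def by measurable
    have "incseq A" unfolding A_def using T(2) by (intro incseq_SucI) blast
    then have "(\<lambda>n. prob (A n)) \<longlonglongrightarrow> prob (\<Union>n. A n)"
      by (intro finite_Lim_measure_incseq) auto
    moreover have "AE x in M. (x, \<phi> c x) \<notin> sym_diff S (\<Union>n. T n)"
      using S_T by (intro rel_measure_null_graph) (auto simp: eq_mod_null_def)
    then have "AE x in M. x \<in> (\<Union>n. A n)"
      using c(2) AE_space by eventually_elim (auto simp: A_def)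
    then have "prob (\<Union>n. A n) = 1" by (intro prob_eq_1[THEN iffD2]) auto
    ultimately show ?thesis by (simp add: A_def)
  qed
  have "prob {x \<in> space M. (x, \<phi> a x) \<in> T n} + prob {x \<in> space M. (x, \<phi> b x) \<in> T n} \<le> 1" for n
  proof (rule finite_relation_ping_pong[OF _ T(3) a(1) b(1) pp_a pp_b disj])
    show "subeq_rel M (orbit_rel G M \<phi>) (T n)"
      using S(1) T(1)[of n] unfolding subeq_rel_def by blast
  qed
  moreover have "(\<lambda>n. prob {x \<in> space M. (x, \<phi> a x) \<in> T n} + prob {x \<in> space M. (x, \<phi> b x) \<in> T n}) \<longlonglongrightarrow> 1 + 1"
    by (intro tendsto_add lim a b)
  ultimately have "(1::real) + 1 \<le> 1" by (intro LIMSEQ_le_const2[of _ "1 + 1" 1]) auto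
  then show False by simp
qed

end

section \<open>Transvections and ping-pong in $SL(n,\mathbb{Z})$\<close>

definition transvection :: "'n::finite \<Rightarrow> 'n \<Rightarrow> int \<Rightarrow> int ^ 'n ^ 'n" where
  "transvection p q c = (\<chi> i j. (if i = j then 1 else 0) + (if i = p \<and> j = q then c else 0))"

lemma transvection_mult_nth:
  "(transvection p q c ** f) $ i $ j = f $ i $ j + (if i = p then c * f $ q $ j else 0)"
proof -
  have "(transvection p q c ** f) $ i $ j =
      (\<Sum>k\<in>UNIV. (if i = k then f $ k $ j else 0) + (if k = q then if i = p then c * f $ k $ j else 0 else 0))"
    unfolding matrix_matrix_mult_def transvection_def by (simp, intro sum.cong) (auto simp: distrib_right)
  also have "\<dots> = f $ i $ j + (if i = p then c * f $ q $ j else 0)"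
    by (subst sum.distrib) simp
  finally show ?thesis .
qed

lemma det_transvection:
  assumes "p \<noteq> q"
  shows "det (transvection p q c) = 1"
proof -
  have "transvection p q c = (\<chi> k. if k = p then row p (mat 1) + c *s row q (mat 1) else row k (mat 1))"
    using assms by (auto simp: vec_eq_iff transvection_def row_def mat_def)
  then show ?thesis using det_row_operation[OF assms, of "mat 1" c] by simp
qed

lemma transvection_add:
  assumes "p \<noteq> q"
  shows "transvection p q c ** transvection p q d = transvection p q (c + d)"
  using assms by (auto simp: vec_eq_iff transvection_mult_nth) (auto simp: transvection_def)

lemma transvection_commute:
  assumes "q \<noteq> r" "s \<noteq> p"
  shows "transvection p q c ** transvection r s d = transvection r s d ** transvection p q c"
  using assms by (auto simp: vec_eq_iff transvection_mult_nth) (auto simp: transvection_def)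

lemma transvection_0: "transvection p q 0 = mat 1"
  by (auto simp: vec_eq_iff transvection_def mat_def)

text \<open>
  Left multiplication by the two transvections acts on the pair \<open>(x, y)\<close> formed by rows \<open>p\<close> and \<open>q\<close> of
  any fixed column as \<open>(x + 3 y, y)\<close> and \<open>(x, y + 3 x)\<close>. The column is chosen so that the pair is
  nonzero; the set of such columns is the same for \<open>f\<close> and for its two images, hence so is the
  chosen one. On the projective line with coordinate \<open>z = x / y\<close> the first map is \<open>z \<mapsto> z + 3\<close>, which
  sends the complement of \<open>z < -1\<close> into \<open>z \<ge> 2\<close>; the second does the same for \<open>1 / z\<close>. Multiplying by
  \<open>y\<^sup>2\<close> and \<open>x\<^sup>2\<close> gives the four sets below, with \<open>z = \<infinity>\<close> in \<open>A\<close> and \<open>z = 0\<close> in \<open>B\<close>.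
\<close>
lemma SL_int_ping_pong:
  fixes p q :: "'n::finite"
  assumes "p \<noteq> q"
  obtains A A' B B' :: "(int ^ 'n ^ 'n) set" where
    "\<And>f. f \<in> carrier SL_int \<Longrightarrow> f \<notin> A' \<Longrightarrow> transvection p q 3 \<otimes>\<^bsub>SL_int\<^esub> f \<in> A"
    "\<And>f. f \<in> carrier SL_int \<Longrightarrow> f \<notin> B' \<Longrightarrow> transvection q p 3 \<otimes>\<^bsub>SL_int\<^esub> f \<in> B"
    "A \<inter> A' = {}" "(A \<union> A') \<inter> B = {}" "(A \<union> A' \<union> B) \<inter> B' = {}"
proof -
  define col where "col f = (SOME k. f $ p $ k \<noteq> 0 \<or> f $ q $ k \<noteq> 0)" for f :: "int ^ 'n ^ 'n"
  define X where "X f = f $ p $ col f" for f :: "int ^ 'n ^ 'n"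
  define Y where "Y f = f $ q $ col f" for f :: "int ^ 'n ^ 'n"
  let ?G = "carrier SL_int :: (int ^ 'n ^ 'n) set"
  have nz: "X f \<noteq> 0 \<or> Y f \<noteq> 0" if "f \<in> ?G" for f
  proof -
    have "row p f \<noteq> 0" using that det_zero_row(1)[of p f] by (auto simp: SL_int_def)
    then have "\<exists>k. f $ p $ k \<noteq> 0 \<or> f $ q $ k \<noteq> 0" by (auto simp: row_def vec_eq_iff)
    then show ?thesis unfolding X_def Y_def col_def by (rule someI_ex)
  qed
  let ?a = "transvection p q 3" and ?b = "transvection q p 3"
  have a: "(?a ** f) $ p $ k = f $ p $ k + 3 * f $ q $ k" "(?a ** f) $ q $ k = f $ q $ k" for f k
    using assms by (simp_all add: transvection_mult_nth)
  have b: "(?b ** f) $ q $ k = f $ q $ k + 3 * f $ p $ k" "(?b ** f) $ p $ k = f $ p $ k" for f k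
    using assms by (simp_all add: transvection_mult_nth)
  have "col (?a ** f) = col f" for f
  proof -
    have "(?a ** f) $ p $ k \<noteq> 0 \<or> (?a ** f) $ q $ k \<noteq> 0 \<longleftrightarrow> f $ p $ k \<noteq> 0 \<or> f $ q $ k \<noteq> 0" for k
      unfolding a by auto
    then show ?thesis unfolding col_def by simp
  qed
  then have Xa: "X (?a ** f) = X f + 3 * Y f" "Y (?a ** f) = Y f" for f
    by (simp_all add: X_def Y_def a)
  have "col (?b ** f) = col f" for f
  proof -
    have "(?b ** f) $ p $ k \<noteq> 0 \<or> (?b ** f) $ q $ k \<noteq> 0 \<longleftrightarrow> f $ p $ k \<noteq> 0 \<or> f $ q $ k \<noteq> 0" for k
      unfolding b by auto
    then show ?thesis unfolding col_def by simp
  qed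
  then have Xb: "Y (?b ** f) = Y f + 3 * X f" "X (?b ** f) = X f" for f
    by (simp_all add: X_def Y_def b)
  have clos: "?a ** f \<in> ?G" "?b ** f \<in> ?G" if "f \<in> ?G" for f
    using that assms by (simp_all add: SL_int_def det_mul det_transvection)
  define A where "A = {f \<in> ?G. X f * Y f \<ge> 2 * Y f * Y f}"
  define A' where "A' = {f \<in> ?G. X f * Y f < - (Y f * Y f)}"
  define B where "B = {f \<in> ?G. X f * Y f \<ge> 2 * X f * X f}"
  define B' where "B' = {f \<in> ?G. X f * Y f < - (X f * X f)}"
  have sq: "X f * X f \<ge> 0" "Y f * Y f \<ge> 0" "(X f + Y f) * (X f + Y f) \<ge> 0" "(X f - Y f) * (X f - Y f) \<ge> 0" for f
    by simp_all
  have pos: "X f * X f + Y f * Y f > 0" if "f \<in> ?G" for f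
    using nz[OF that] by (simp add: sum_squares_gt_zero_iff)
  have "?a \<otimes>\<^bsub>SL_int\<^esub> f \<in> A" if "f \<in> ?G" "f \<notin> A'" for f
    using that clos by (simp add: A_def A'_def SL_int_def Xa algebra_simps)
  moreover have "?b \<otimes>\<^bsub>SL_int\<^esub> f \<in> B" if "f \<in> ?G" "f \<notin> B'" for f
    using that clos by (simp add: B_def B'_def SL_int_def Xb algebra_simps)
  moreover have False if f: "f \<in> A" "f \<in> A'" for f
    using f sq[of f] by (simp add: A_def A'_def)
  moreover have False if f: "f \<in> A" "f \<in> B" for f
  proof -
    have "f \<in> ?G" using f by (simp add: A_def)
    then show False using f sq[of f] pos[of f] by (simp add: A_def B_def algebra_simps)
  qed
  moreover have False if f: "f \<in> A'" "f \<in> B" for f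
    using f sq[of f] by (simp add: A'_def B_def)
  moreover have False if f: "f \<in> A" "f \<in> B'" for f
    using f sq[of f] by (simp add: A_def B'_def)
  moreover have False if f: "f \<in> A'" "f \<in> B'" for f
    using f sq[of f] by (simp add: A'_def B'_def algebra_simps)
  moreover have False if f: "f \<in> B" "f \<in> B'" for f
    using f sq[of f] by (simp add: B_def B'_def)
  ultimately show thesis by (intro that[of A' A B' B]) blast+
qed

section \<open>A chain of commuting unipotent subgroups\<close>

lemma rank_one_extend:
  assumes "rank_one M R" "subeq_rel M R W" "aperiodic_rel M W" "hyperfinite_rel M W"
  obtains S where "maximal_hyperfinite M R S" "subset_mod_null M W S"
  using assms unfolding rank_one_def by blast

text \<open>
  In rank one the maximal hyperfinite relation above \<open>L\<close> is unique up to null sets, so \<open>S1\<close> and \<open>S2\<close>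
  contain the same graphs up to null sets.
\<close>
lemma rank_one_transfer:
  assumes R: "rank_one M R" and L: "subeq_rel M R L" "aperiodic_rel M L" "hyperfinite_rel M L"
    and S1: "maximal_hyperfinite M R S1" "subset_mod_null M L S1"
    and S2: "maximal_hyperfinite M R S2" "subset_mod_null M L S2"
    and g: "g \<in> M \<rightarrow>\<^sub>M M" "AE x in M. (x, g x) \<in> S1"
  shows "AE x in M. (x, g x) \<in> S2"
proof -
  obtain S' where S': "maximal_hyperfinite M R S'" "eq_mod_null M S' S1" "eq_mod_null M S' S2"
    using assms(1-8) unfolding rank_one_def by metis
  have [measurable]: "S1 \<in> sets (M \<Otimes>\<^sub>M M)" "S2 \<in> sets (M \<Otimes>\<^sub>M M)" "S' \<in> sets (M \<Otimes>\<^sub>M M)"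
    using S1(1) S2(1) S'(1) by (simp_all add: maximal_hyperfinite_def subeq_rel_def)
  have "AE x in M. (x, g x) \<notin> sym_diff S' S1"
    using S'(2) g(1) by (intro rel_measure_null_graph) (auto simp: eq_mod_null_def)
  moreover have "AE x in M. (x, g x) \<notin> sym_diff S' S2"
    using S'(3) g(1) by (intro rel_measure_null_graph) (auto simp: eq_mod_null_def)
  ultimately show ?thesis using g(2) by eventually_elim auto
qed

lemma subset_mod_null_mono:
  assumes "L \<subseteq> W" "subset_mod_null M W S"
  shows "subset_mod_null M L S"
  using assms rel_measure_mono[of "L - S" "W - S" M] by (auto simp: subset_mod_null_def)

locale free_SL_action = free_pmp_action M U SL_int \<phi>
  for M :: "'a measure" and U and \<phi> :: "int ^ 'n ^ 'n \<Rightarrow> 'a \<Rightarrow> 'a"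
begin

text \<open>The orbit relation of the one-parameter unipotent subgroup with off-diagonal entry \<open>(p, q)\<close>.\<close>
definition line :: "'n \<Rightarrow> 'n \<Rightarrow> ('a \<times> 'a) set" where
  "line p q = {(x, \<phi> (transvection p q c) x) | x c. x \<in> space M}"

lemma transvection_carrier: "p \<noteq> q \<Longrightarrow> transvection p q c \<in> carrier SL_int"
  by (simp add: SL_int_def det_transvection)

text \<open>
  Under these conditions on the indices the two one-parameter subgroups commute and meet trivially,
  so together they form a copy of \<open>\<int>\<^sup>2\<close> acting freely.
\<close>
lemma plane_action_transvections:
  assumes pq: "p \<noteq> q" and rs: "r \<noteq> s" and comm: "q \<noteq> r" "s \<noteq> p" and ne: "(p, q) \<noteq> (r, s)"
  shows "plane_action M U (\<lambda>v. \<phi> (transvection p q (fst v) ** transvection r s (snd v)))"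
proof -
  define E where "E v = transvection p q (fst v) ** transvection r s (snd v)" for v :: "int \<times> int"
  have E_carrier: "E v \<in> carrier SL_int" for v
    using pq rs by (simp add: E_def SL_int_def det_mul det_transvection)
  have E_add: "E (v + w) = E v \<otimes>\<^bsub>SL_int\<^esub> E w" for v w
  proof -
    have "E v ** E w = transvection p q (fst v) ** (transvection r s (snd v) ** transvection p q (fst w)) **
        transvection r s (snd w)"
      by (simp add: E_def matrix_mul_assoc)
    also have "\<dots> = transvection p q (fst v) ** (transvection p q (fst w) ** transvection r s (snd v)) **
        transvection r s (snd w)"
      using transvection_commute[OF comm] by metis
    also have "\<dots> = (transvection p q (fst v) ** transvection p q (fst w)) **
        (transvection r s (snd v) ** transvection r s (snd w))"
      by (simp add: matrix_mul_assoc)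
    also have "\<dots> = E (v + w)" using pq rs by (simp add: E_def transvection_add)
    finally show ?thesis by (simp add: SL_int_def)
  qed
  have E_0: "E 0 = \<one>\<^bsub>SL_int\<^esub>" by (simp add: E_def SL_int_def transvection_0)
  have E_1: "v = 0" if "E v = \<one>\<^bsub>SL_int\<^esub>" for v
  proof -
    have m: "E v $ i $ j = (if i = j then 1 else 0)" for i j using that by (simp add: SL_int_def mat_def)
    have "fst v = 0" using m[of p q] pq comm ne
      by (auto simp: E_def transvection_mult_nth) (auto simp: transvection_def)
    moreover from this have "snd v = 0" using m[of r s] rs
      by (simp add: E_def transvection_0) (simp add: transvection_def)
    ultimately show ?thesis by (simp add: prod_eq_iff)
  qed
  have "plane_action M U (\<lambda>v. \<phi> (E v))"
  proof
    show "\<phi> (E v) \<in> M \<rightarrow>\<^sub>M M" for v by (rule act_measurable[OF E_carrier])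
    show "distr M M (\<phi> (E v)) = M" for v by (rule act_distr[OF E_carrier])
    show "\<phi> (E 0) x = x" if "x \<in> space M" for x using that by (simp only: E_0 act_one)
    show "\<phi> (E (v + w)) x = \<phi> (E v) (\<phi> (E w) x)" if "x \<in> space M" for v w x
      unfolding E_add by (rule composition_rule[OF that E_carrier E_carrier])
    show "AE x in M. \<forall>v. \<phi> (E v) x = x \<longrightarrow> v = 0"
      using act_free
    proof eventually_elim
      fix x assume stab: "stabilizer SL_int \<phi> x = {\<one>\<^bsub>SL_int\<^esub>}"
      show "\<forall>v. \<phi> (E v) x = x \<longrightarrow> v = 0"
      proof (intro allI impI)
        fix v assume "\<phi> (E v) x = x"
        then have "E v \<in> stabilizer SL_int \<phi> x" using E_carrier by (simp add: stabilizer_def)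
        then show "v = 0" using stab E_1 by simp
      qed
    qed
  qed
  then show ?thesis by (simp add: E_def)
qed

text \<open>The relation \<open>W\<close> is the orbit relation of the copy of \<open>\<int>\<^sup>2\<close> generated by the two subgroups.\<close>
lemma commuting_lines:
  assumes pq: "p \<noteq> q" and rs: "r \<noteq> s" and comm: "q \<noteq> r" "s \<noteq> p" and ne: "(p, q) \<noteq> (r, s)"
  obtains W where "subeq_rel M (orbit_rel SL_int M \<phi>) W" "aperiodic_rel M W" "hyperfinite_rel M W"
    "line p q \<subseteq> W" "line r s \<subseteq> W" "subeq_rel M (orbit_rel SL_int M \<phi>) (line p q)"
    "aperiodic_rel M (line p q)" "hyperfinite_rel M (line p q)"
proof -
  define E where "E v = transvection p q (fst v) ** transvection r s (snd v)" for v :: "int \<times> int"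
  interpret plane: plane_action M U "\<lambda>v. \<phi> (E v)"
    unfolding E_def by (rule plane_action_transvections[OF assms])
  let ?R = "orbit_rel SL_int M \<phi>"
  let ?W = "plane.plane_orbits UNIV"
  have E_carrier: "E v \<in> carrier SL_int" for v
    using pq rs by (simp add: E_def SL_int_def det_mul det_transvection)
  have sub_R: "plane.plane_orbits H \<subseteq> ?R" for H
    using E_carrier unfolding plane.plane_orbits_def orbit_rel_def by blast
  have E_fst: "E (c, 0) = transvection p q c" and E_snd: "E (0, c) = transvection r s c" for c
    by (simp_all add: E_def transvection_0)
  have line_pq: "line p q = plane.plane_orbits (UNIV \<times> {0})"
    unfolding line_def plane.plane_orbits_def E_fst[symmetric] by blast
  have line_rs: "line r s = plane.plane_orbits ({0} \<times> UNIV)"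
    unfolding line_def plane.plane_orbits_def E_snd[symmetric] by blast
  have W: "subeq_rel M ?R ?W" by (rule plane.subeq_orbits) (auto simp: sub_R)
  have sub_W: "line p q \<subseteq> ?W" "line r s \<subseteq> ?W"
    by (auto simp: line_pq line_rs plane.plane_orbits_def)
  have sub_line: "subeq_rel M R' (line p q)" if "line p q \<subseteq> R'" for R'
    using that unfolding line_pq by (intro plane.subeq_orbits) (auto simp: zero_prod_def)
  show thesis
  proof (rule that[OF W _ plane.hyperfinite_plane_orbits sub_W])
    show "aperiodic_rel M ?W"
      by (rule plane.aperiodic_orbits) (simp add: finite_prod)
    show "aperiodic_rel M (line p q)"
      unfolding line_pq by (rule plane.aperiodic_orbits) (simp add: finite_cartesian_product_iff)
    show "subeq_rel M ?R (line p q)"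
      using sub_R by (intro sub_line) (simp add: line_pq)
    show "hyperfinite_rel M (line p q)"
      by (rule hyperfinite_subrelation[OF plane.hyperfinite_plane_orbits sub_line[OF sub_W(1)]])
  qed
qed

lemma line_graph_AE:
  assumes "p \<noteq> q" "line p q \<subseteq> W" "subset_mod_null M W S"
    "subeq_rel M R W" "subeq_rel M R S"
  shows "AE x in M. (x, \<phi> (transvection p q c) x) \<in> S"
proof -
  have "AE x in M. (x, \<phi> (transvection p q c) x) \<notin> W - S"
    using assms transvection_carrier[OF assms(1)]
    by (intro rel_measure_null_graph act_measurable sets.Diff) (auto simp: subset_mod_null_def subeq_rel_def)
  then show ?thesis using AE_space
  proof eventually_elim
    fix x assume x: "(x, \<phi> (transvection p q c) x) \<notin> W - S" "x \<in> space M"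
    then have "(x, \<phi> (transvection p q c) x) \<in> line p q" unfolding line_def by blast
    with x(1) assms(2) show "(x, \<phi> (transvection p q c) x) \<in> S" by blast
  qed
qed

text \<open>
  The positions \<open>(p, q)\<close>, \<open>(p, r)\<close>, \<open>(q, r)\<close>, \<open>(q, p)\<close> form a chain of consecutively commuting
  one-parameter subgroups. Neighbouring pairs \<open>W1\<close>, \<open>W2\<close>, \<open>W3\<close> overlap in a line, which forces their
  maximal hyperfinite extensions \<open>S1\<close>, \<open>S2\<close>, \<open>S3\<close> to agree. So \<open>S1\<close> contains the graphs of two
  ping-pong partners.
\<close>
lemma not_rank_one:
  assumes "CARD('n) \<ge> 3"
  shows "\<not> rank_one M (orbit_rel SL_int M \<phi>)"
proof
  let ?R = "orbit_rel SL_int M \<phi>"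
  assume rank: "rank_one M ?R"
  obtain p q r :: 'n where pqr: "p \<noteq> q" "p \<noteq> r" "q \<noteq> r"
    using obtain_subset_with_card_n[OF assms] unfolding card_3_iff by metis
  obtain W1 where W1: "subeq_rel M ?R W1" "aperiodic_rel M W1" "hyperfinite_rel M W1"
      "line p q \<subseteq> W1" "line p r \<subseteq> W1"
    by (rule commuting_lines[of p q p r]) (use pqr in auto)
  obtain W2 where W2: "subeq_rel M ?R W2" "aperiodic_rel M W2" "hyperfinite_rel M W2"
      "line p r \<subseteq> W2" "line q r \<subseteq> W2"
    and pr: "subeq_rel M ?R (line p r)" "aperiodic_rel M (line p r)" "hyperfinite_rel M (line p r)"
    by (rule commuting_lines[of p r q r]) (use pqr in auto)
  obtain W3 where W3: "subeq_rel M ?R W3" "aperiodic_rel M W3" "hyperfinite_rel M W3"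
      "line q r \<subseteq> W3" "line q p \<subseteq> W3"
    and qr: "subeq_rel M ?R (line q r)" "aperiodic_rel M (line q r)" "hyperfinite_rel M (line q r)"
    by (rule commuting_lines[of q r q p]) (use pqr in auto)
  obtain S1 where S1: "maximal_hyperfinite M ?R S1" "subset_mod_null M W1 S1"
    by (rule rank_one_extend[OF rank W1(1-3)])
  obtain S2 where S2: "maximal_hyperfinite M ?R S2" "subset_mod_null M W2 S2"
    by (rule rank_one_extend[OF rank W2(1-3)])
  obtain S3 where S3: "maximal_hyperfinite M ?R S3" "subset_mod_null M W3 S3"
    by (rule rank_one_extend[OF rank W3(1-3)])
  have S1_sub: "subeq_rel M ?R S1" and S1_hyp: "hyperfinite_rel M S1" and S3_sub: "subeq_rel M ?R S3"
    using S1(1) S3(1) by (simp_all add: maximal_hyperfinite_def)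
  have a: "transvection p q 3 \<in> carrier SL_int" and b: "transvection q p 3 \<in> carrier SL_int"
    using pqr by (simp_all add: transvection_carrier)
  have aS: "AE x in M. (x, \<phi> (transvection p q 3) x) \<in> S1"
    by (rule line_graph_AE[OF pqr(1) W1(4) S1(2) W1(1) S1_sub])
  have "AE x in M. (x, \<phi> (transvection q p 3) x) \<in> S3"
    by (rule line_graph_AE[OF pqr(1)[symmetric] W3(5) S3(2) W3(1) S3_sub])
  then have "AE x in M. (x, \<phi> (transvection q p 3) x) \<in> S2"
    by (rule rank_one_transfer[OF rank qr S3(1) subset_mod_null_mono[OF W3(4) S3(2)]
        S2(1) subset_mod_null_mono[OF W2(5) S2(2)] act_measurable[OF b]])
  then have bS: "AE x in M. (x, \<phi> (transvection q p 3) x) \<in> S1"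
    by (rule rank_one_transfer[OF rank pr S2(1) subset_mod_null_mono[OF W2(4) S2(2)]
        S1(1) subset_mod_null_mono[OF W1(5) S1(2)] act_measurable[OF b]])
  show False
    by (rule SL_int_ping_pong[OF pqr(1)], rule ping_pong_not_hyperfinite[OF S1_sub S1_hyp a aS b bS])
qed

end

theorem corollary4p6:
  fixes M :: "'a measure"
    and \<phi> :: "int ^ 'n ^ 'n \<Rightarrow> 'a \<Rightarrow> 'a"
  assumes "CARD('n) \<ge> 3"
    and "standard_borel M"
    and "pmp_action SL_int M \<phi>"
    and "ergodic_action SL_int M \<phi>"
    and "essentially_free SL_int M \<phi>"
  shows "higher_rank M (orbit_rel SL_int M \<phi>)"
proof -
  obtain U where U: "separating_sequence M U"
    by (rule standard_borel_separating_sequence[OF assms(2)])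
  have "free_SL_action M U \<phi>"
    unfolding free_SL_action_def free_pmp_action_def free_pmp_action_axioms_def
    using U assms(3,5) unfolding pmp_action_def essentially_free_def
    by (auto intro: countableI_type)
  then show ?thesis
    unfolding higher_rank_def using assms(1) by (rule free_SL_action.not_rank_one)
qed

end
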